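(* The Wasserstein distance between the empirical predictive output-input distribution $\overline{\mathbb{P}}^{\hat{\mathcal M}}$ and the true output-input distribution $\mathbb{P}^{\mathcal M}$ satisfies $$d_W(\overline{\mathbb{P}}^{\hat{\mathcal M}},\mathbb{P}^{\mathcal M})\le\frac1N\sum_{i=1}^N\Big(\|\hat\Phi(R_\Phi-I)(\hat{\mathbf{y}}_0+\hat\Theta\mathbf{e}_i)\|+\|\hat\Phi R_\Phi(\tilde{\mathbf{y}}_0+\tilde\Theta\mathbf{e}_i)\|\Big)+\|(R_\phi-I)\hat\phi\|+\|\hat\Phi R_\Phi(\hat\Theta+\tilde\Theta)\|\,d_W(\overline{\mathbb{P}}_{\mathbf{e}},\mathbb{P}_{\mathbf{e}}).$$
   Context: Norms: $\|\cdot\|$ is the 1-norm for vectors and the induced 1-norm for matrices. System: over times $0,\dots,T$, with $u_t\in\mathbb{R}^m$, $y_t,e_t\in\mathbb{R}^q$ and stacked vectors $\mathbf{y},\mathbf{u},\mathbf{e}$, the true system is $\mathbf{y}=\mathbf{G}\mathbf{u}+\mathbf{y}_0+\Theta\mathbf{e}$, the stacked form of $x_{t+1}=Ax_t+Bu_t+Le_t$, $y_t=Cx_t+Du_t+e_t$: $\mathbf{G}=\mathbf{C}\mathbf{T}_u+\mathbf{D}$, $\Theta=\mathbf{C}\mathbf{T}_e+I$, where $\mathbf{C},\mathbf{D}$ are block diagonal with $T+1$ copies of $C$, $D$, and $\mathbf{T}_u$ (resp. $\mathbf{T}_e$) has $(i,j)$ block $A^{i-j-1}B$ (resp. $A^{i-j-1}L$)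 for $i>j$ and $0$ otherwise; $\mathbf{y}_0$ is a fixed vector determined by past data. Matrices are partitioned into $(T+1)\times(T+1)$ blocks (size $q$ for output, $m$ for input coordinates); block-lower-triangular means $(i,j)$ block zero for $j>i$, block strictly-lower-triangular means zero for $j\ge i$. $\mathbf{G}$ is block-lower-triangular. Nominal parameters $(\hat{\mathbf{G}},\hat\Theta,\hat{\mathbf{y}}_0)$ of the same sizes are given, $\hat{\mathbf{G}}$ block-lower-triangular; $\Delta:=\mathbf{G}-\hat{\mathbf{G}}$, $\tilde\Theta:=\Theta-\hat\Theta$, $\tilde{\mathbf{y}}_0:=\mathbf{y}_0-\hat{\mathbf{y}}_0$. The nominal closed-loop parameterization $\hat\Phi=\begin{bmatrix}\hat\Phi_y\\ \hat\Phi_u\end{bmatrix}$, $\hat\phi=\begin{bmatrix}\hat\phi_y\\ \hat\phi_u\end{bmatrix}$ has $\hat\Phi_y$ block-lower-triangular, $\hat\Phi_u$ block strictly-lower-triangular, and satisfies $\begin{bmatrix} I & -\hat{\mathbf{G}}\end{bmatrix}\begin{bmatrix}\hat\Phi&\hat\phi\end{bmatrix}=\begin{bmatrix} I & 0\end{bmatrix}$. Put $$R_\Phi=(I-\Delta\hat\Phi_u)^{-1},\qquad R_\phi=\begin{bmatrix} I&\hat\Phi_yR_\Phi\Delta\\0&I+\hat\Phi_uR_\Phi\Delta\end{bmatrix}.$$ The true closed-loop output-input response $\bm\eta=\mathrm{col}(\mathbf{y},\mathbf{u})$ (under the policy $\mathbf{u}=\mathbf{K}\mathbf{y}+\mathbf{p}$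 with $\mathbf{K}=\hat\Phi_u\hat\Phi_y^{-1}$, $\mathbf{p}=\hat\phi_u-\mathbf{K}\hat\phi_y$) is $\bm\eta=\hat\Phi R_\Phi(\mathbf{y}_0+\Theta\mathbf{e})+R_\phi\hat\phi$. Distributions: $\mathbf{e}\sim\mathbb{P}_{\mathbf{e}}$, with $N$ given samples $\mathbf{e}_1,\dots,\mathbf{e}_N$; $\delta(\cdot)$ is the Dirac distribution; $\overline{\mathbb{P}}_{\mathbf{e}}=\frac1N\sum_{i=1}^N\delta(\mathbf{e}_i)$; $\mathbb{P}^{\mathcal M}$ is the distribution of $\bm\eta$ when $\mathbf{e}\sim\mathbb{P}_{\mathbf{e}}$; $\overline{\mathbb{P}}^{\hat{\mathcal M}}=\frac1N\sum_{i=1}^N\delta(\hat{\bm\eta}_i)$ with $\hat{\bm\eta}_i=\hat\Phi(\hat{\mathbf{y}}_0+\hat\Theta\mathbf{e}_i)+\hat\phi$. Wasserstein distance: $d_W(\mathbb{Q}_1,\mathbb{Q}_2)=\inf_\Pi\int\|\xi_1-\xi_2\|\,\Pi(d\xi_1,d\xi_2)$ over joint distributions $\Pi$ with marginals $\mathbb{Q}_1,\mathbb{Q}_2$, defined for distributions with finite first moment $\int\|\xi\|\,\mathbb{Q}(d\xi)<\infty$; $\mathbb{P}_{\mathbf{e}}$ is such a distribution. *)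

theory Defs
  imports "HOL-Probability.Probability"
begin

text \<open>
  The horizon \<open>0, \<dots>, T\<close> is a type \<open>'t\<close> of sort \<open>{finite, linorder}\<close> with \<open>T + 1 = CARD('t)\<close>; every
  \<open>T \<ge> 0\<close> occurs. A stacked signal with \<open>k\<close>-dimensional entries is a vector indexed by
  \<open>'t \<times> 'k\<close>, and \<open>col(y, u)\<close> is indexed by a disjoint sum.
\<close>

definition time_index :: "'t::{finite,linorder} \<Rightarrow> nat" where
  "time_index t = card {s. s < t}"

subsection \<open>Block matrices\<close>

definition block :: "real^('t \<times> 'b)^('t \<times> 'a) \<Rightarrow> 't::finite \<Rightarrow> 't \<Rightarrow> real^'b::finite^'a::finite" where
  "block M i j = (\<chi> a b. M $ (i, a) $ (j, b))"

definition of_blocks :: "('t::finite \<Rightarrow> 't \<Rightarrow> real^'b::finite^'a::finite) \<Rightarrow> real^('t \<times> 'b)^('t \<times> 'a)" where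
  "of_blocks F = (\<chi> r c. F (fst r) (fst c) $ snd r $ snd c)"

definition block_lower_triangular ::
  "real^('t::{finite,linorder} \<times> 'b::finite)^('t \<times> 'a::finite) \<Rightarrow> bool" where
  "block_lower_triangular M \<longleftrightarrow> (\<forall>i j. i < j \<longrightarrow> block M i j = 0)"

definition block_strictly_lower_triangular ::
  "real^('t::{finite,linorder} \<times> 'b::finite)^('t \<times> 'a::finite) \<Rightarrow> bool" where
  "block_strictly_lower_triangular M \<longleftrightarrow> (\<forall>i j. i \<le> j \<longrightarrow> block M i j = 0)"

text \<open>Since matrices are vectors of rows, \<open>vstack\<close> stacks both vectors and matrices.\<close>

definition vstack :: "'a^'n::finite \<Rightarrow> 'a^'k::finite \<Rightarrow> 'a^('n + 'k)" where
  "vstack x y = (\<chi> i. case i of Inl a \<Rightarrow> x $ a | Inr b \<Rightarrow> y $ b)"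

definition hstack :: "'a^'n::finite^'r::finite \<Rightarrow> 'a^'k::finite^'r \<Rightarrow> 'a^('n + 'k)^'r" where
  "hstack M N = (\<chi> r. vstack (M $ r) (N $ r))"

subsection \<open>The stacked system\<close>

definition block_diag :: "real^'b::finite^'a::finite \<Rightarrow> real^('t::finite \<times> 'b)^('t \<times> 'a)" where
  "block_diag M = of_blocks (\<lambda>i j. if i = j then M else 0)"

text \<open>The operator \<open>^\<close> on type \<open>vec\<close> would be componentwise, hence the explicit iteration.\<close>

definition mat_power :: "real^'n::finite^'n \<Rightarrow> nat \<Rightarrow> real^'n^'n" where
  "mat_power A k = ((**) A ^^ k) (mat 1)"

definition propagator ::
  "real^'n::finite^'n \<Rightarrow> real^'k::finite^'n \<Rightarrow> real^('t::{finite,linorder} \<times> 'k)^('t \<times> 'n)" where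
  "propagator A B = of_blocks (\<lambda>i j.
     if j < i then mat_power A (time_index i - time_index j - 1) ** B else 0)"

definition stacked_G ::
  "real^'n::finite^'n \<Rightarrow> real^'m::finite^'n \<Rightarrow> real^'n^'q::finite \<Rightarrow> real^'m^'q
     \<Rightarrow> real^('t::{finite,linorder} \<times> 'm)^('t \<times> 'q)" where
  "stacked_G A B C D = block_diag C ** propagator A B + block_diag D"

definition stacked_Theta ::
  "real^'n::finite^'n \<Rightarrow> real^'q::finite^'n \<Rightarrow> real^'n^'q
     \<Rightarrow> real^('t::{finite,linorder} \<times> 'q)^('t \<times> 'q)" where
  "stacked_Theta A L C = block_diag C ** propagator A L + mat 1"

subsection \<open>Norms, empirical distributions, Wasserstein distance\<close>

text \<open>The library norm on \<^typ>\<open>real^'n\<close> is Euclidean.\<close>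

definition norm1 :: "real^'n::finite \<Rightarrow> real" where
  "norm1 x = (\<Sum>i\<in>UNIV. \<bar>x $ i\<bar>)"

definition mat_norm1 :: "real^'n::finite^'k::finite \<Rightarrow> real" where
  "mat_norm1 M = (SUP x\<in>{x. norm1 x = 1}. norm1 (M *v x))"

definition empirical :: "nat \<Rightarrow> (nat \<Rightarrow> 'a::topological_space) \<Rightarrow> 'a measure" where
  "empirical N x =
     measure_of UNIV (sets borel) (\<lambda>S. (\<Sum>i=1..N. emeasure (return borel (x i)) S) / of_nat N)"

definition finite_first_moment :: "(real^'n::finite) measure \<Rightarrow> bool" where
  "finite_first_moment Q \<longleftrightarrow> (\<integral>\<^sup>+ x. ennreal (norm1 x) \<partial>Q) < \<infinity>"

definition couplings ::
  "'a::topological_space measure \<Rightarrow> 'a measure \<Rightarrow> ('a \<times> 'a) measure set" where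
  "couplings Q1 Q2 = {W. prob_space W \<and> sets W = sets (borel \<Otimes>\<^sub>M borel) \<and>
                         distr W borel fst = Q1 \<and> distr W borel snd = Q2}"

text \<open>
  Valued in \<open>[0, \<infinity>]\<close>, so that no value is lost to undefined integrals; it is finite for
  distributions with finite first moment.
\<close>

definition wasserstein :: "(real^'n::finite) measure \<Rightarrow> (real^'n) measure \<Rightarrow> ennreal" where
  "wasserstein Q1 Q2 = (INF W\<in>couplings Q1 Q2. \<integral>\<^sup>+ z. ennreal (norm1 (fst z - snd z)) \<partial>W)"

subsection \<open>Closed-form expression of the closed loop\<close>

lemma lower_mult_strictly_lower:
  assumes "block_lower_triangular M" and "block_strictly_lower_triangular N"
  shows "block_strictly_lower_triangular (M ** N)"
proof -
  have M: "M $ (i, a) $ (j, b) = 0" if "i < j" for i j a b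
    using assms(1) that by (simp add: block_lower_triangular_def block_def vec_eq_iff)
  have N: "N $ (i, a) $ (j, b) = 0" if "i \<le> j" for i j a b
    using assms(2) that by (simp add: block_strictly_lower_triangular_def block_def vec_eq_iff)
  have "M $ (i, a) $ (k, c) * N $ (k, c) $ (j, b) = 0" if "i \<le> j" for i j k a b c
    using M[of i k a c] N[of k j c b] that by (cases "i < k") auto
  hence "(\<Sum>k\<in>UNIV. M $ (i, a) $ k * N $ k $ (j, b)) = 0" if "i \<le> j" for i j a b
    using that by (intro sum.neutral) auto
  thus ?thesis
    by (simp add: block_strictly_lower_triangular_def block_def vec_eq_iff matrix_matrix_mult_def)
qed

lemma invertible_id_plus_strictly_lower:
  fixes M :: "real^('t::{finite,linorder} \<times> 'a::finite)^('t \<times> 'a)"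
  assumes "block_strictly_lower_triangular M"
  shows "invertible (mat 1 + M)"
proof -
  have M: "M $ (i, a) $ (j, b) = 0" if "i \<le> j" for i j a b
    using assms that by (simp add: block_strictly_lower_triangular_def block_def vec_eq_iff)
  have "x = 0" if "(mat 1 + M) *v x = 0" for x
  proof -
    from that have "x + M *v x = 0"
      by (simp add: matrix_vector_mult_add_rdistrib)
    hence x: "x $ r = - (\<Sum>k\<in>UNIV. M $ r $ k * x $ k)" for r
      by (cases r) (simp add: vec_eq_iff matrix_vector_mult_def eq_neg_iff_add_eq_0)
    have "x $ (i, a) = 0" for i a
    proof (induction "card {s. s < i}" arbitrary: i a rule: less_induct)
      case less
      have "M $ (i, a) $ (j, b) * x $ (j, b) = 0" for j b
      proof (cases "j < i")
        case True
        hence "card {s. s < j} < card {s. s < i}"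
          by (intro psubset_card_mono) auto
        with less show ?thesis by simp
      qed (use M in auto)
      thus ?case by (subst x) (auto intro!: sum.neutral)
    qed
    thus ?thesis by (auto simp: vec_eq_iff)
  qed
  thus ?thesis
    by (auto simp: invertible_left_inverse matrix_left_invertible_ker)
qed

lemma matrix_inv_both:
  assumes "invertible (M :: real^'n::finite^'n)"
  shows "M ** matrix_inv M = mat 1" "matrix_inv M ** M = mat 1"
  using assms someI_ex[of "\<lambda>A'. M ** A' = mat 1 \<and> A' ** M = mat 1"]
  by (auto simp: matrix_inv_def invertible_def)

lemma stacked_G_lower:
  "block_lower_triangular (stacked_G A B C D :: real^('t::{finite,linorder} \<times> _)^('t \<times> _))"
proof -
  have "block_diag C $ (i, a) $ k * propagator A B $ k $ (j, b) = 0" if "i < j" for i j :: 't and a b k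
    using that
    by (cases k) (auto simp: block_diag_def propagator_def of_blocks_def)
  hence "(block_diag C ** propagator A B) $ (i, a) $ (j, b) = 0" if "i < j" for i j :: 't and a b
    using that by (auto simp: matrix_matrix_mult_def intro!: sum.neutral)
  thus ?thesis
    by (auto simp: stacked_G_def block_lower_triangular_def block_def vec_eq_iff
        block_diag_def of_blocks_def)
qed

lemma all_sum_iff: "(\<forall>x. P x) \<longleftrightarrow> (\<forall>a. P (Inl a)) \<and> (\<forall>b. P (Inr b))"
  by (metis sum.exhaust)

lemma vstack_nth [simp]: "vstack a b $ Inl i = a $ i" "vstack a b $ Inr j = b $ j"
  by (simp_all add: vstack_def)

lemma vstack_eq_iff: "vstack a b = vstack c d \<longleftrightarrow> a = c \<and> b = d"
  by (auto simp: vec_eq_iff all_sum_iff)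

lemma vstack_mult_vector: "vstack M N *v x = vstack (M *v x) (N *v x)"
  by (auto simp: vec_eq_iff all_sum_iff matrix_vector_mult_def)

lemma vstack_mult: "vstack M N ** Q = vstack (M ** Q) (N ** Q)"
  by (auto simp: vec_eq_iff all_sum_iff matrix_matrix_mult_def)

lemma vstack_add: "vstack a b + vstack c d = vstack (a + c) (b + d)"
  by (auto simp: vec_eq_iff all_sum_iff)

lemma sum_UNIV_sum:
  "(\<Sum>k\<in>UNIV. f k) = (\<Sum>a\<in>UNIV. f (Inl a)) + (\<Sum>b\<in>UNIV. f (Inr b))"
  for f :: "'a::finite + 'b::finite \<Rightarrow> real"
  by (subst UNIV_Plus_UNIV[symmetric], subst sum.Plus) auto

lemma hstack_mult_vstack: "hstack M N *v vstack x y = M *v x + N *v (y :: real^_)"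
  by (simp add: vec_eq_iff matrix_vector_mult_def hstack_def sum_UNIV_sum)

lemma hstack_mult_vstack_matrix: "hstack M N ** vstack P Q = M ** P + N ** (Q :: real^_^_)"
  by (simp add: vec_eq_iff matrix_matrix_mult_def hstack_def sum_UNIV_sum)

theorem closed_loop_response:
  fixes G Ghat Delta :: "real^('t::{finite,linorder} \<times> 'm::finite)^('t \<times> 'q::finite)"
    and y :: "real^('t \<times> 'q)" and u :: "real^('t \<times> 'm)"
  assumes G: "block_lower_triangular G"
    and Ghat: "block_lower_triangular Ghat"
    and Delta: "Delta = G - Ghat"
    and Phi_u: "block_strictly_lower_triangular Phi_u"
    and Phi: "Phi = vstack Phi_y Phi_u"
    and phi: "phi = vstack phi_y phi_u"
    and achievable_Phi: "hstack (mat 1) (- Ghat) ** Phi = mat 1"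
    and achievable_phi: "hstack (mat 1) (- Ghat) *v phi = 0"
    and R_Phi: "R_Phi = matrix_inv (mat 1 - Delta ** Phi_u)"
    and R_phi: "R_phi = vstack (hstack (mat 1) (Phi_y ** R_Phi ** Delta))
                               (hstack 0 (mat 1 + Phi_u ** R_Phi ** Delta))"
    and K: "K = Phi_u ** matrix_inv Phi_y"
    and p: "p = phi_u - K *v phi_y"
  shows "y = G *v u + w \<and> u = K *v y + p \<longleftrightarrow>
         vstack y u = (Phi ** R_Phi) *v w + R_phi *v phi"
proof -
  have Phi_y: "Phi_y = mat 1 + Ghat ** Phi_u"
  proof -
    have "Phi_y + (- Ghat) ** Phi_u = mat 1"
      using achievable_Phi by (simp add: Phi hstack_mult_vstack_matrix)
    moreover have "(- Ghat) ** Phi_u = - (Ghat ** Phi_u)"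
      by (simp add: vec_eq_iff matrix_matrix_mult_def sum_negf)
    ultimately show ?thesis by (simp add: algebra_simps)
  qed
  have phi_y: "phi_y = Ghat *v phi_u"
  proof -
    have "phi_y + (- Ghat) *v phi_u = 0"
      using achievable_phi by (simp add: phi hstack_mult_vstack)
    moreover have "(- Ghat) *v phi_u = - (Ghat *v phi_u)"
      by (simp add: vec_eq_iff matrix_vector_mult_def sum_negf)
    ultimately show ?thesis by (simp add: algebra_simps)
  qed
  have "invertible Phi_y"
    unfolding Phi_y
    by (intro invertible_id_plus_strictly_lower lower_mult_strictly_lower Ghat Phi_u)
  note inv_y = matrix_inv_both[OF this]
  have "block_lower_triangular (- Delta)"
    using G Ghat by (simp add: Delta block_lower_triangular_def block_def vec_eq_iff)
  hence "invertible (mat 1 + (- Delta) ** Phi_u)"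
    by (intro invertible_id_plus_strictly_lower lower_mult_strictly_lower Phi_u)
  also have "mat 1 + (- Delta) ** Phi_u = mat 1 - Delta ** Phi_u"
    by (simp add: vec_eq_iff matrix_matrix_mult_def sum_negf)
  finally have "invertible (mat 1 - Delta ** Phi_u)" .
  note inv_R = matrix_inv_both[OF this, folded R_Phi]
  note vec = matrix_vector_mul_assoc[symmetric] matrix_vector_mult_add_rdistrib
    matrix_vector_mult_diff_rdistrib matrix_vector_right_distrib
    matrix_vector_mult_diff_distrib
  have policy: "u = K *v y + p \<longleftrightarrow> (\<exists>s. y = Phi_y *v s + phi_y \<and> u = Phi_u *v s + phi_u)"
  proof
    assume "u = K *v y + p"
    hence "u = Phi_u *v (matrix_inv Phi_y *v (y - phi_y)) + phi_u"
      by (simp add: K p vec)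
    moreover have "y = Phi_y *v (matrix_inv Phi_y *v (y - phi_y)) + phi_y"
      by (simp add: matrix_vector_mul_assoc inv_y)
    ultimately show "\<exists>s. y = Phi_y *v s + phi_y \<and> u = Phi_u *v s + phi_u" by blast
  next
    assume "\<exists>s. y = Phi_y *v s + phi_y \<and> u = Phi_u *v s + phi_u"
    then obtain s where s: "y = Phi_y *v s + phi_y" "u = Phi_u *v s + phi_u" by blast
    have "matrix_inv Phi_y *v (Phi_y *v s) = s"
      by (simp add: matrix_vector_mul_assoc inv_y)
    thus "u = K *v y + p"
      by (simp add: s K p vec)
  qed
  have system: "y = G *v u + w \<longleftrightarrow> s = R_Phi *v (w + Delta *v phi_u)"
    if s: "y = Phi_y *v s + phi_y" "u = Phi_u *v s + phi_u" for s
  proof -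
    have "y = G *v u + w \<longleftrightarrow> (mat 1 - Delta ** Phi_u) *v s = w + Delta *v phi_u"
      by (simp add: s phi_y Phi_y Delta vec algebra_simps)
    also have "\<dots> \<longleftrightarrow> s = R_Phi *v (w + Delta *v phi_u)"
      by (metis inv_R matrix_vector_mul_assoc matrix_vector_mul_lid)
    finally show ?thesis .
  qed
  have "(y = G *v u + w \<and> u = K *v y + p) \<longleftrightarrow>
        (let s = R_Phi *v (w + Delta *v phi_u) in y = Phi_y *v s + phi_y \<and> u = Phi_u *v s + phi_u)"
    unfolding policy Let_def using system by blast
  also have "\<dots> \<longleftrightarrow> vstack y u = (Phi ** R_Phi) *v w + R_phi *v phi"
    by (simp add: Phi R_phi phi vstack_mult vstack_mult_vector vstack_add vstack_eq_iff
        hstack_mult_vstack vec algebra_simps)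
  finally show ?thesis .
qed

end

(*
  The closed-loop map and its nominal counterpart are affine, so any coupling of the noise
  distributions is pushed forward by (e, e') |-> (eta_hat e, eta e') to a coupling of the
  output-input distributions. Its cost is bounded pointwise through the intermediate point eta e:
  the model error norm1 (eta_hat e - eta e) integrates to an average over the samples, while
  norm1 (eta e - eta e') is at most the induced norm of the linear part times norm1 (e - e').
  No gluing of couplings is needed.
*)

theory Submission
  imports Defs
begin

subsection \<open>The 1-norm\<close>

lemma norm1_nonneg [simp]: "0 \<le> norm1 x"
  by (simp add: norm1_def sum_nonneg)

lemma norm1_triangle: "norm1 (x + y) \<le> norm1 x + norm1 y"
  by (simp add: norm1_def sum.distrib[symmetric] sum_mono)

lemma norm1_minus [simp]: "norm1 (- x) = norm1 x"
  by (simp add: norm1_def)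

lemma norm1_scaleR: "norm1 (c *\<^sub>R x) = \<bar>c\<bar> * norm1 x"
  by (simp add: norm1_def abs_mult sum_distrib_left)

lemma norm1_eq_0_iff: "norm1 x = 0 \<longleftrightarrow> x = 0"
  by (simp add: norm1_def sum_nonneg_eq_0_iff vec_eq_iff)

lemma continuous_on_norm1: "continuous_on S norm1"
  unfolding norm1_def [abs_def] by (intro continuous_intros)

lemma borel_measurable_norm1 [measurable]: "norm1 \<in> borel_measurable borel"
  by (intro borel_measurable_continuous_onI continuous_on_norm1)

text \<open>A crude entrywise bound. Its purpose is to show that the set under the supremum in
  \<open>mat_norm1\<close> is bounded above; a real \<open>SUP\<close> gives no upper bound
  otherwise.\<close>

lemma norm1_matrix_vector_mult_le_entries:
  "norm1 (M *v x) \<le> (\<Sum>i\<in>UNIV. \<Sum>j\<in>UNIV. \<bar>M $ i $ j\<bar>) * norm1 x"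
proof -
  have comp: "\<bar>x $ j\<bar> \<le> norm1 x" for j
    unfolding norm1_def by (rule member_le_sum) auto
  have "norm1 (M *v x) \<le> (\<Sum>i\<in>UNIV. \<Sum>j\<in>UNIV. \<bar>M $ i $ j * x $ j\<bar>)"
    unfolding norm1_def matrix_vector_mult_def by (auto intro!: sum_mono sum_abs)
  also have "\<dots> \<le> (\<Sum>i\<in>UNIV. \<Sum>j\<in>UNIV. \<bar>M $ i $ j\<bar> * norm1 x)"
    by (intro sum_mono) (auto simp: abs_mult intro!: mult_left_mono comp)
  finally show ?thesis
    by (simp add: sum_distrib_right)
qed

text \<open>By homogeneity a nonzero \<open>x\<close> can be rescaled to the unit sphere of
  \<open>norm1\<close>, where the supremum applies.\<close>

lemma norm1_matrix_vector_mult_le: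
  fixes M :: "real^'a^'b"
  shows "norm1 (M *v x) \<le> mat_norm1 M * norm1 x"
proof (cases "x = 0")
  case True
  thus ?thesis by (simp add: norm1_def)
next
  case False
  define c where "c = norm1 x"
  have c: "c > 0"
    using False norm1_eq_0_iff[of x] norm1_nonneg[of x] unfolding c_def by linarith
  have "bdd_above ((\<lambda>x. norm1 (M *v x)) ` {x. norm1 x = 1})"
  proof (rule bdd_aboveI2)
    fix x :: "real^'a" assume "x \<in> {x. norm1 x = 1}"
    thus "norm1 (M *v x) \<le> (\<Sum>i\<in>UNIV. \<Sum>j\<in>UNIV. \<bar>M $ i $ j\<bar>)"
      using norm1_matrix_vector_mult_le_entries[of M x] by simp
  qed
  moreover have "norm1 ((1 / c) *\<^sub>R x) = 1"
    using c by (simp add: norm1_scaleR c_def)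
  ultimately have "norm1 (M *v ((1 / c) *\<^sub>R x)) \<le> mat_norm1 M"
    unfolding mat_norm1_def by (intro cSUP_upper) auto
  hence "norm1 (M *v x) / c \<le> mat_norm1 M"
    using c by (simp add: matrix_vector_mult_scaleR norm1_scaleR)
  thus ?thesis
    using c by (simp add: c_def divide_simps)
qed

lemma mat_norm1_nonneg: "0 \<le> mat_norm1 (M :: real^'a^'b)"
proof -
  \<comment> \<open>\<open>1\<close> is the all-ones vector: any vector of positive norm, put into
    the operator bound, forces the sign of \<open>mat_norm1 M\<close>.\<close>
  have "norm1 (1 :: real^'a) > 0"
    by (simp add: norm1_def)
  moreover have "0 \<le> mat_norm1 M * norm1 (1 :: real^'a)"
    using norm1_matrix_vector_mult_le[of M 1] norm1_nonneg order_trans by blast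
  ultimately show ?thesis
    by (simp add: zero_le_mult_iff)
qed

lemma borel_measurable_matrix_vector_mult [measurable]:
  fixes M :: "real^'n^'k"
  shows "(\<lambda>x. M *v x) \<in> borel_measurable borel"
  by (intro borel_measurable_continuous_onI matrix_vector_mult_linear_continuous_on)

subsection \<open>Empirical distributions\<close>

lemma measurable_uniform_count_measure [measurable]: "x \<in> uniform_count_measure A \<rightarrow>\<^sub>M borel"
  by (simp add: measurable_def space_uniform_count_measure sets_uniform_count_measure)

text \<open>As the image of the uniform distribution on the indices, the empirical distribution
  inherits countable additivity, its push-forwards are compositions, and its integrals are finite
  sums. \<open>N \<ge> 1\<close> makes the index set nonempty.\<close>

lemma empirical_eq_distr:
  assumes "N \<ge> 1"
  shows "empirical N x = distr (uniform_count_measure {1..N}) borel x"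
proof -
  have "emeasure (distr (uniform_count_measure {1..N}) borel x) S =
        (\<Sum>i=1..N. emeasure (return borel (x i)) S) / of_nat N" if S: "S \<in> sets borel" for S
  proof -
    \<comment> \<open>The integral of the indicator is a finite sum with weights
      \<open>1 / N\<close>, and \<open>indicator S (x i)\<close> is the Dirac mass of
      \<open>S\<close> at \<open>x i\<close>.\<close>
    have "emeasure (distr (uniform_count_measure {1..N}) borel x) S =
          (\<integral>\<^sup>+ i. indicator S (x i) \<partial>uniform_count_measure {1..N})"
      using S by (simp add: nn_integral_indicator[symmetric] nn_integral_distr del: nn_integral_indicator)
    also have "\<dots> = (\<Sum>i=1..N. emeasure (return borel (x i)) S) / of_nat N"
      using S assms
      by (simp add: uniform_count_measure_def nn_integral_point_measure_finite
          sum_distrib_left[symmetric] divide_ennreal_def mult.commute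
          inverse_ennreal[symmetric] ennreal_of_nat_eq_real_of_nat divide_inverse)
    finally show ?thesis .
  qed
  \<comment> \<open>\<open>measure_of\<close> depends only on the values on Borel sets, and applied
    to the values of an actual measure it returns that measure.\<close>
  hence "empirical N x = measure_of UNIV (sets borel)
           (emeasure (distr (uniform_count_measure {1..N}) borel x))"
    unfolding empirical_def
    by (intro measure_of_eq) (auto simp: sets.sigma_sets_eq[of borel, simplified])
  also have "\<dots> = distr (uniform_count_measure {1..N}) borel x"
    using measure_of_of_measure[of "distr (uniform_count_measure {1..N}) borel x"] by simp
  finally show ?thesis .
qed

lemma sets_empirical [simp, measurable_cong]: "sets (empirical N x) = sets borel"
  by (simp add: empirical_def sets.sigma_sets_eq[of borel, simplified])

lemma prob_space_empirical:
  assumes "N \<ge> 1"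
  shows "prob_space (empirical N x)"
  unfolding empirical_eq_distr[OF assms]
  using assms
  by (intro prob_space.prob_space_distr prob_space_uniform_count_measure
      measurable_uniform_count_measure) auto

lemma distr_empirical:
  assumes "N \<ge> 1" and [measurable]: "f \<in> borel_measurable borel"
  shows "distr (empirical N x) borel f = empirical N (\<lambda>i. f (x i))"
  unfolding empirical_eq_distr[OF assms(1)]
  by (simp add: distr_distr comp_def)

lemma nn_integral_empirical:
  assumes "N \<ge> 1" and "f \<in> borel_measurable borel" and "\<And>z. 0 \<le> f z"
  shows "(\<integral>\<^sup>+ z. ennreal (f z) \<partial>empirical N x) = ennreal (1 / real N * (\<Sum>i=1..N. f (x i)))"
proof -
  have "(\<integral>\<^sup>+ z. ennreal (f z) \<partial>empirical N x) =
        (\<integral>\<^sup>+ i. ennreal (f (x i)) \<partial>uniform_count_measure {1..N})"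
    unfolding empirical_eq_distr[OF assms(1)] using assms(2)
    by (simp add: nn_integral_distr)
  thus ?thesis
    using assms
    by (simp add: uniform_count_measure_def nn_integral_point_measure_finite
        ennreal_mult[symmetric] sum_ennreal sum_distrib_left)
qed

subsection \<open>Couplings\<close>

text \<open>The independent coupling; it witnesses that the infimum defining
  \<open>wasserstein\<close> ranges over a nonempty set.\<close>

lemma pair_measure_in_couplings:
  assumes "prob_space Q1" "prob_space Q2" "sets Q1 = sets borel" "sets Q2 = sets borel"
  shows "Q1 \<Otimes>\<^sub>M Q2 \<in> couplings Q1 Q2"
proof -
  interpret Q1: prob_space Q1 by fact
  interpret Q2: prob_space Q2 by fact
  interpret pair_prob_space Q1 Q2 ..
  have "distr (Q1 \<Otimes>\<^sub>M Q2) borel fst = distr (Q1 \<Otimes>\<^sub>M Q2) Q1 fst"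
    by (rule distr_cong) (simp_all add: assms)
  moreover have "distr (Q1 \<Otimes>\<^sub>M Q2) Q1 fst = Q1"
    by (rule Q2.distr_pair_fst)
  moreover have "distr (Q1 \<Otimes>\<^sub>M Q2) borel snd = distr (Q1 \<Otimes>\<^sub>M Q2) Q2 snd"
    by (rule distr_cong) (simp_all add: assms)
  \<comment> \<open>The preimage of \<open>S\<close> under \<open>snd\<close> is the rectangle
    \<open>space Q1 \<times> S\<close>, and \<open>Q1\<close> has total mass 1.\<close>
  moreover have "distr (Q1 \<Otimes>\<^sub>M Q2) Q2 snd = Q2"
  proof (rule measure_eqI)
    fix S assume "S \<in> sets (distr (Q1 \<Otimes>\<^sub>M Q2) Q2 snd)"
    hence S: "S \<in> sets Q2" by simp
    hence "snd -` S \<inter> space (Q1 \<Otimes>\<^sub>M Q2) = space Q1 \<times> S"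
      using sets.sets_into_space[OF S] by (auto simp: space_pair_measure)
    thus "emeasure (distr (Q1 \<Otimes>\<^sub>M Q2) Q2 snd) S = emeasure Q2 S"
      using S by (simp add: emeasure_distr Q2.emeasure_pair_measure_Times Q1.emeasure_space_1)
  qed simp
  ultimately show ?thesis
    using sets_pair_measure_cong[OF assms(3,4)] prob_space_axioms
    by (simp add: couplings_def)
qed

text \<open>Projecting after \<open>map_prod f g\<close> is the same as projecting first and then
  applying \<open>f\<close> or \<open>g\<close>, so each marginal is transported separately,
  whatever the dependence in \<open>W\<close>.\<close>

lemma distr_map_prod_in_couplings:
  assumes W: "W \<in> couplings Q1 Q2"
    and [measurable]: "f \<in> borel_measurable borel" "g \<in> borel_measurable borel"
  shows "distr W (borel \<Otimes>\<^sub>M borel) (map_prod f g) \<in> couplings (distr Q1 borel f) (distr Q2 borel g)"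
proof -
  interpret W: prob_space W
    using W by (simp add: couplings_def)
  have [measurable_cong]: "sets W = sets (borel \<Otimes>\<^sub>M borel)"
    using W by (simp add: couplings_def)
  have Q: "Q1 = distr W borel fst" "Q2 = distr W borel snd"
    using W by (simp_all add: couplings_def)
  have [measurable]: "map_prod f g \<in> W \<rightarrow>\<^sub>M borel \<Otimes>\<^sub>M borel"
    unfolding map_prod_def case_prod_beta by measurable
  show ?thesis
    unfolding couplings_def Q
    by (auto intro!: W.prob_space_distr distr_cong simp: distr_distr comp_def)
qed

text \<open>A monotone right-continuous map commutes with the infimum of a nonempty set.
  Multiplication by \<open>ennreal c\<close> is continuous even at \<infinity> because the factor is
  finite.\<close>

lemma INF_affine_ennreal:
  fixes f :: "'a \<Rightarrow> ennreal"
  assumes "I \<noteq> {}"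
  shows "(INF i\<in>I. a + ennreal c * f i) = a + ennreal c * (INF i\<in>I. f i)"
proof -
  have "continuous_on UNIV (\<lambda>x. a + ennreal c * x)"
    by (intro continuous_on_add_ennreal ennreal_continuous_on_cmult continuous_on_const
        continuous_on_id) simp
  hence "continuous (at_right x) (\<lambda>x. a + ennreal c * x)" for x
    by (metis UNIV_I continuous_on_eq_continuous_within continuous_within_subset subset_UNIV)
  moreover have "mono (\<lambda>x. a + ennreal c * x)"
    by (auto intro!: monoI add_left_mono mult_left_mono)
  ultimately show ?thesis
    using continuous_at_Inf_mono[of "\<lambda>x. a + ennreal c * x" "f ` I"] assms
    by (simp add: image_comp)
qed

text \<open>The term \<open>h\<close> sees only the first argument, so its integral is fixed by the
  marginal \<open>Q1\<close> and is the same for every coupling; only the cost scaled by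
  \<open>c\<close> remains to be minimized.\<close>

theorem wasserstein_distr_le:
  fixes f g :: "real^'n \<Rightarrow> real^'k"
  assumes Q1: "prob_space Q1" "sets Q1 = sets borel"
    and Q2: "prob_space Q2" "sets Q2 = sets borel"
    and f [measurable]: "f \<in> borel_measurable borel"
    and g [measurable]: "g \<in> borel_measurable borel"
    and h [measurable]: "h \<in> borel_measurable borel"
    and h_nonneg: "\<And>x. 0 \<le> h x" and c: "0 \<le> c"
    and le: "\<And>x x'. norm1 (f x - g x') \<le> h x + c * norm1 (x - x')"
  shows "wasserstein (distr Q1 borel f) (distr Q2 borel g)
           \<le> (\<integral>\<^sup>+ x. ennreal (h x) \<partial>Q1) + ennreal c * wasserstein Q1 Q2"
proof -
  let ?cost = "\<lambda>W. \<integral>\<^sup>+ z. ennreal (norm1 (fst z - snd z)) \<partial>W"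
  have step: "wasserstein (distr Q1 borel f) (distr Q2 borel g)
                \<le> (\<integral>\<^sup>+ x. ennreal (h x) \<partial>Q1) + ennreal c * ?cost W"
    if W: "W \<in> couplings Q1 Q2" for W
  proof -
    have [measurable_cong]: "sets W = sets (borel \<Otimes>\<^sub>M borel)"
      using W by (simp add: couplings_def)
    have [measurable]: "map_prod f g \<in> W \<rightarrow>\<^sub>M borel \<Otimes>\<^sub>M borel"
      unfolding map_prod_def case_prod_beta by measurable
    have "wasserstein (distr Q1 borel f) (distr Q2 borel g)
            \<le> ?cost (distr W (borel \<Otimes>\<^sub>M borel) (map_prod f g))"
      unfolding wasserstein_def by (intro INF_lower distr_map_prod_in_couplings W f g)
    also have "\<dots> = (\<integral>\<^sup>+ z. ennreal (norm1 (f (fst z) - g (snd z))) \<partial>W)"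
      by (subst nn_integral_distr) auto
    \<comment> \<open>Since \<open>ennreal\<close> sends negative reals to 0, splitting it over the
      sum and the product relies on \<open>h_nonneg\<close> and \<open>c\<close>.\<close>
    also have "\<dots> \<le> (\<integral>\<^sup>+ z. ennreal (h (fst z)) + ennreal c * ennreal (norm1 (fst z - snd z)) \<partial>W)"
      by (intro nn_integral_mono)
        (auto simp: ennreal_mult[symmetric] ennreal_plus[symmetric] h_nonneg c
          simp del: ennreal_plus intro!: ennreal_leI le)
    also have "\<dots> = (\<integral>\<^sup>+ z. ennreal (h (fst z)) \<partial>W) + ennreal c * ?cost W"
      by (subst nn_integral_add) (auto simp: nn_integral_cmult)
    also have "(\<integral>\<^sup>+ z. ennreal (h (fst z)) \<partial>W) = (\<integral>\<^sup>+ x. ennreal (h x) \<partial>distr W borel fst)"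
      by (subst nn_integral_distr) auto
    also have "distr W borel fst = Q1"
      using W by (simp add: couplings_def)
    finally show ?thesis .
  qed
  \<comment> \<open>Without a coupling the infimum would be \<open>\<infinity>\<close>, and \<open>c = 0\<close> would give \<open>0 * \<infinity> = 0\<close>.\<close>
  have ne: "couplings Q1 Q2 \<noteq> {}"
    using pair_measure_in_couplings[OF Q1(1) Q2(1) Q1(2) Q2(2)] by blast
  have "wasserstein (distr Q1 borel f) (distr Q2 borel g)
          \<le> (INF W\<in>couplings Q1 Q2. (\<integral>\<^sup>+ x. ennreal (h x) \<partial>Q1) + ennreal c * ?cost W)"
    by (intro INF_greatest step)
  also have "\<dots> = (\<integral>\<^sup>+ x. ennreal (h x) \<partial>Q1) + ennreal c * wasserstein Q1 Q2"
    unfolding wasserstein_def by (rule INF_affine_ennreal[OF ne])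
  finally show ?thesis .
qed

subsection \<open>The closed loop\<close>

theorem proposition1:
  fixes A :: "real^'n^'n" and B :: "real^'m^'n" and C :: "real^'n^'q"
    and D :: "real^'m^'q" and L :: "real^'q^'n"
    and G Ghat Delta :: "real^('t::{finite,linorder} \<times> 'm)^('t \<times> 'q)"
    and Theta Theta_hat Theta_tilde :: "real^('t \<times> 'q)^('t \<times> 'q)"
    and y0 y0_hat y0_tilde :: "real^('t \<times> 'q)"
    and Phi_y :: "real^('t \<times> 'q)^('t \<times> 'q)"
    and Phi_u :: "real^('t \<times> 'q)^('t \<times> 'm)"
    and Phi :: "real^('t \<times> 'q)^('t \<times> 'q + 't \<times> 'm)"
    and phi_y :: "real^('t \<times> 'q)" and phi_u :: "real^('t \<times> 'm)"
    and phi :: "real^('t \<times> 'q + 't \<times> 'm)"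
    and R_Phi :: "real^('t \<times> 'q)^('t \<times> 'q)"
    and R_phi :: "real^('t \<times> 'q + 't \<times> 'm)^('t \<times> 'q + 't \<times> 'm)"
    and K :: "real^('t \<times> 'q)^('t \<times> 'm)" and p :: "real^('t \<times> 'm)"
    and y :: "real^('t \<times> 'q) \<Rightarrow> real^('t \<times> 'q)"
    and u :: "real^('t \<times> 'q) \<Rightarrow> real^('t \<times> 'm)"
    and eta eta_hat :: "real^('t \<times> 'q) \<Rightarrow> real^('t \<times> 'q + 't \<times> 'm)"
    and P :: "(real^('t \<times> 'q)) measure"
    and N :: nat and es :: "nat \<Rightarrow> real^('t \<times> 'q)"
  assumes G: "G = stacked_G A B C D"
    and Theta: "Theta = stacked_Theta A L C"
    and Ghat: "block_lower_triangular Ghat"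
    and Delta: "Delta = G - Ghat"
    and Theta_tilde: "Theta_tilde = Theta - Theta_hat"
    and y0_tilde: "y0_tilde = y0 - y0_hat"
    and Phi_y: "block_lower_triangular Phi_y"
    and Phi_u: "block_strictly_lower_triangular Phi_u"
    and Phi: "Phi = vstack Phi_y Phi_u"
    and phi: "phi = vstack phi_y phi_u"
    and achievable_Phi: "hstack (mat 1) (- Ghat) ** Phi = mat 1"
    and achievable_phi: "hstack (mat 1) (- Ghat) *v phi = 0"
    and R_Phi: "R_Phi = matrix_inv (mat 1 - Delta ** Phi_u)"
    and R_phi: "R_phi = vstack (hstack (mat 1) (Phi_y ** R_Phi ** Delta))
                               (hstack 0 (mat 1 + Phi_u ** R_Phi ** Delta))"
    and K: "K = Phi_u ** matrix_inv Phi_y"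
    and p: "p = phi_u - K *v phi_y"
    and system: "\<And>e. y e = G *v u e + y0 + Theta *v e"
    and policy: "\<And>e. u e = K *v y e + p"
    and eta: "\<And>e. eta e = vstack (y e) (u e)"
    and eta_hat: "\<And>e. eta_hat e = Phi *v (y0_hat + Theta_hat *v e) + phi"
    and P: "prob_space P" "sets P = sets borel" "finite_first_moment P"
    and N: "N \<ge> 1"
  shows "wasserstein (empirical N (\<lambda>i. eta_hat (es i))) (distr P borel eta)
    \<le> ennreal (1 / real N * (\<Sum>i=1..N.
           norm1 ((Phi ** (R_Phi - mat 1)) *v (y0_hat + Theta_hat *v es i))
         + norm1 ((Phi ** R_Phi) *v (y0_tilde + Theta_tilde *v es i)))
         + norm1 ((R_phi - mat 1) *v phi))
      + ennreal (mat_norm1 (Phi ** R_Phi ** (Theta_hat + Theta_tilde)))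
        * wasserstein (empirical N es) P"
proof -
  let ?H = "\<lambda>e. norm1 ((Phi ** (R_Phi - mat 1)) *v (y0_hat + Theta_hat *v e))
         + norm1 ((Phi ** R_Phi) *v (y0_tilde + Theta_tilde *v e))
         + norm1 ((R_phi - mat 1) *v phi)"
  let ?M = "Phi ** R_Phi ** (Theta_hat + Theta_tilde)"
  note vec = matrix_vector_mul_assoc[symmetric] matrix_vector_mult_add_rdistrib
    matrix_vector_mult_diff_rdistrib matrix_vector_right_distrib
    matrix_vector_mult_diff_distrib
  \<comment> \<open>The loop equations determine the response: they are solved by
    \<open>closed_loop_response\<close> with disturbance \<open>w = y0 + Theta *v e\<close>.\<close>
  have eta_eq: "eta e = (Phi ** R_Phi) *v (y0 + Theta *v e) + R_phi *v phi" for e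
  proof -
    have "y e = G *v u e + (y0 + Theta *v e)"
      using system[of e] by (simp only: add.assoc)
    with policy[of e] show ?thesis
      unfolding eta
      by (intro closed_loop_response[OF _ Ghat Delta Phi_u Phi phi achievable_Phi achievable_phi
            R_Phi R_phi K p, THEN iffD1]) (auto simp only: G stacked_G_lower)
  qed
  have [measurable]: "eta \<in> borel_measurable borel" "eta_hat \<in> borel_measurable borel"
    unfolding eta_eq [abs_def] eta_hat [abs_def] by measurable
  \<comment> \<open>Add and subtract \<open>(Phi ** R_Phi) *v (y0_hat + Theta_hat *v e)\<close>,
    which separates the error in the closed-loop map from the errors in \<open>y0\<close> and
    \<open>Theta\<close>.\<close>
  have "eta e - eta_hat e = (Phi ** (R_Phi - mat 1)) *v (y0_hat + Theta_hat *v e)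
      + (Phi ** R_Phi) *v (y0_tilde + Theta_tilde *v e) + (R_phi - mat 1) *v phi" for e
    by (simp add: eta_eq eta_hat y0_tilde Theta_tilde vec algebra_simps)
  hence "norm1 (eta e - eta_hat e) \<le> ?H e" for e
    by (simp only:) (intro order_trans[OF norm1_triangle] add_right_mono norm1_triangle)
  hence model: "norm1 (eta_hat e - eta e) \<le> ?H e" for e
    by (subst norm1_minus[symmetric]) (simp only: minus_diff_eq)
  \<comment> \<open>The terms without noise cancel, and \<open>Theta_hat + Theta_tilde\<close> is
    the true \<open>Theta\<close>.\<close>
  have "eta e - eta e' = ?M *v (e - e')" for e e'
    by (simp add: eta_eq Theta_tilde vec algebra_simps)
  hence noise: "norm1 (eta e - eta e') \<le> mat_norm1 ?M * norm1 (e - e')" for e e'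
    by (simp only: norm1_matrix_vector_mult_le)
  have le: "norm1 (eta_hat e - eta e') \<le> ?H e + mat_norm1 ?M * norm1 (e - e')" for e e'
    using norm1_triangle[of "eta_hat e - eta e" "eta e - eta e'"] model[of e] noise[of e e']
    by simp
  have "wasserstein (distr (empirical N es) borel eta_hat) (distr P borel eta)
      \<le> (\<integral>\<^sup>+ e. ennreal (?H e) \<partial>empirical N es)
        + ennreal (mat_norm1 ?M) * wasserstein (empirical N es) P"
    by (rule wasserstein_distr_le[OF prob_space_empirical[OF N] sets_empirical P(1,2)])
      (auto intro!: le mat_norm1_nonneg)
  also have "(\<integral>\<^sup>+ e. ennreal (?H e) \<partial>empirical N es) = ennreal (1 / real N * (\<Sum>i=1..N. ?H (es i)))"
    by (rule nn_integral_empirical[OF N]) auto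
  \<comment> \<open>The last summand of \<open>?H\<close> does not depend on the sample, so
    averaging leaves it unchanged; here \<open>N\<close> must be nonzero.\<close>
  also have "1 / real N * (\<Sum>i=1..N. ?H (es i)) = 1 / real N * (\<Sum>i=1..N.
           norm1 ((Phi ** (R_Phi - mat 1)) *v (y0_hat + Theta_hat *v es i))
         + norm1 ((Phi ** R_Phi) *v (y0_tilde + Theta_tilde *v es i)))
         + norm1 ((R_phi - mat 1) *v phi)"
    using N by (simp add: sum.distrib field_simps)
  finally show ?thesis
    by (simp only: distr_empirical[OF N \<open>eta_hat \<in> borel_measurable borel\<close>])
qed

end
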